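(* Let $W$ be ULC($n$) with support $\{0,1,\ldots,n\}$ and mean $nr>0$. Let $Z\sim\mathrm{Bin}(n,r)$ and let $\{X_t:t\in\mathbb{Z}^+\}$ be the sequence of random variables associated with $W$ as defined in the context. Then $X_t\leq_{cx}X_u$ for all $t,u\in\mathbb{Z}^+$ with $t\leq u$. In particular, $W\leq_{cx}Z$.
   Context: $n\geq1$ is an integer, $\mathbb{Z}^+=\{0,1,2,\ldots\}$. $\leq_{cx}$ is the usual convex order: $X\leq_{cx}Y$ iff $\mathbb{E}f(X)\leq\mathbb{E}f(Y)$ for all convex $f$. The support of $W$ is the set of $i$ with $\mathbb{P}(W=i)>0$. ULC($n$): a random variable $X$ supported on $\{0,1,\ldots,n\}$ is ultra log-concave of degree $n$ if $$\frac{\mathbb{P}(X=i+1)^2}{\binom{n}{i+1}^2}\geq\frac{\mathbb{P}(X=i)}{\binom{n}{i}}\,\frac{\mathbb{P}(X=i+2)}{\binom{n}{i+2}},\qquad 0\leq i\leq n-2.$$ The sequence $X_t$: $X_0$ has the law of $W$. Given $X_t$ (taking values in $\{0,\ldots,n\}$), let $\eta_t$ be Bernoulli with mean $r$ independent of $X_t$ (the $\eta_t$ being iid), and let $X_{t+1}$ be the hypergeometric thinning of $X_t+\eta_t\in\{0,\ldots,n+1\}$: for $0\le i\le n$, $\mathbb{P}(X_{t+1}=i)=\frac{n+1-i}{n+1}\mathbb{P}(X_t+\eta_t=i)+\frac{i+1}{n+1}\mathbb{P}(X_t+\eta_t=i+1)$. Equivalently, with $p_t(i)=\mathbb{P}(X_t=i)$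 ($p_t(-1)=p_t(n+1)=0$) and $q=1-r$, $$p_{t+1}(i)=\frac{(n+1-i)(q\,p_t(i)+r\,p_t(i-1))+(i+1)(q\,p_t(i+1)+r\,p_t(i))}{n+1}.$$ Each $X_t$ is supported on $\{0,\ldots,n\}$ and has mean $nr$. *)

theory Defs
  imports "HOL-Probability.Probability"
begin

text \<open>
  All the notions below depend only on the laws of the random variables involved, so a
  random variable with values in the natural numbers is represented by its law, a
  \<^typ>\<open>nat pmf\<close>.
\<close>

text \<open>
  The usual convex order, for all convex functions on the real line whose two expectations
  exist. For finitely supported laws every expectation exists.
\<close>

definition convex_order :: "real pmf \<Rightarrow> real pmf \<Rightarrow> bool" where
  "convex_order P Q \<longleftrightarrow>
     (\<forall>f :: real \<Rightarrow> real. convex_on UNIV f \<longrightarrow>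
        integrable (measure_pmf P) f \<longrightarrow> integrable (measure_pmf Q) f \<longrightarrow>
        measure_pmf.expectation P f \<le> measure_pmf.expectation Q f)"

abbreviation cx_le :: "nat pmf \<Rightarrow> nat pmf \<Rightarrow> bool"  (infix "\<le>cx" 50) where
  "P \<le>cx Q \<equiv> convex_order (map_pmf real P) (map_pmf real Q)"

text \<open>The index range is written \<^prop>\<open>i + 2 \<le> n\<close> to avoid truncated subtraction for n = 1.\<close>

definition ULC :: "nat \<Rightarrow> nat pmf \<Rightarrow> bool" where
  "ULC n P \<longleftrightarrow> set_pmf P \<subseteq> {0..n} \<and>
     (\<forall>i. i + 2 \<le> n \<longrightarrow>
        (pmf P (i + 1))\<^sup>2 / (real (n choose (i + 1)))\<^sup>2
          \<ge> pmf P i / real (n choose i) * (pmf P (i + 2) / real (n choose (i + 2))))"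

text \<open>
  Hypergeometric thinning of a value s in {0..n+1}: of n + 1 balls, s of which are marked,
  one chosen uniformly is removed and the number of marked balls left is returned. Values
  s > n + 1 do not occur. The lemmas below give the resulting mass functions.
\<close>

definition hyp_thin :: "nat \<Rightarrow> nat \<Rightarrow> nat pmf" where
  "hyp_thin n s =
     map_pmf (\<lambda>removed. if removed then s - 1 else s) (bernoulli_pmf (real s / real (n + 1)))"

definition add_bernoulli :: "real \<Rightarrow> nat pmf \<Rightarrow> nat pmf" where
  "add_bernoulli r P =
     map_pmf (\<lambda>(x, \<eta>). x + of_bool \<eta>) (pair_pmf P (bernoulli_pmf r))"

primrec assoc_seq :: "nat \<Rightarrow> real \<Rightarrow> nat pmf \<Rightarrow> nat \<Rightarrow> nat pmf" where
  "assoc_seq n r W 0 = W"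
| "assoc_seq n r W (Suc t) = bind_pmf (add_bernoulli r (assoc_seq n r W t)) (hyp_thin n)"

lemma pmf_add_bernoulli:
  assumes "0 \<le> r" "r \<le> 1"
  shows "pmf (add_bernoulli r P) i = (1 - r) * pmf P i + r * (if i = 0 then 0 else pmf P (i - 1))"
proof -
  have "add_bernoulli r P = bind_pmf (bernoulli_pmf r) (\<lambda>e. map_pmf (\<lambda>x. x + of_bool e) P)"
    unfolding add_bernoulli_def pair_pmf_def
    by (subst bind_commute_pmf) (simp add: map_bind_pmf map_pmf_def bind_assoc_pmf bind_return_pmf)
  moreover have "pmf (map_pmf Suc P) i = (if i = 0 then 0 else pmf P (i - 1))"
    by (cases i) (auto simp: pmf_map_inj' pmf_eq_0_set_pmf)
  ultimately show ?thesis
    using assms by (simp add: pmf_bind mult.commute)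
qed

lemma pmf_hyp_thin:
  assumes "s \<le> n + 1"
  shows "pmf (hyp_thin n s) i =
    (real (n + 1) - real i) / real (n + 1) * indicator {i} s
      + (real i + 1) / real (n + 1) * indicator {i + 1} s"
proof -
  have "pmf (hyp_thin n s) i = real s / real (n + 1) * indicator {i} (s - 1)
     + (1 - real s / real (n + 1)) * indicator {i} s"
    using assms unfolding hyp_thin_def map_pmf_def
    by (auto simp: pmf_bind field_simps indicator_def)
  then show ?thesis
    using assms by (cases s) (auto simp: indicator_def field_simps)
qed

lemma pmf_bind_hyp_thin:
  assumes "set_pmf S \<subseteq> {0..n + 1}"
  shows "pmf (bind_pmf S (hyp_thin n)) i =
    (real (n + 1) - real i) / real (n + 1) * pmf S i
      + (real i + 1) / real (n + 1) * pmf S (i + 1)"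
proof -
  have fin: "finite (set_pmf S)"
    using assms finite_subset by blast
  have le: "s \<le> n + 1" if "s \<in> set_pmf S" for s
    using that assms by auto
  have "pmf (bind_pmf S (hyp_thin n)) i = measure_pmf.expectation S (\<lambda>s.
      (real (n + 1) - real i) / real (n + 1) * indicator {i} s
      + (real i + 1) / real (n + 1) * indicator {i + 1} s)"
    unfolding pmf_bind
    by (rule integral_cong_AE, simp, simp, unfold AE_measure_pmf_iff)
      (use pmf_hyp_thin[OF le] in blast)
  then show ?thesis
    by (simp add: integrable_measure_pmf_finite[OF fin] pmf.rep_eq)
qed

lemma set_assoc_seq:
  assumes "set_pmf W \<subseteq> {0..n}"
  shows "set_pmf (assoc_seq n r W t) \<subseteq> {0..n}"
proof (induction t)
  case 0
  then show ?case using assms by simp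
next
  case (Suc t)
  have *: "s \<le> n + 1" if "s \<in> set_pmf (add_bernoulli r (assoc_seq n r W t))" for s
    using that Suc by (fastforce simp: add_bernoulli_def)
  have "i \<le> n" if "s \<le> n + 1" "i \<in> set_pmf (hyp_thin n s)" for s i
  proof (rule ccontr)
    assume "\<not> i \<le> n"
    then have "pmf (hyp_thin n s) i = 0"
      using that(1) by (auto simp: pmf_hyp_thin indicator_def)
    then show False
      using that(2) by (simp add: set_pmf_iff)
  qed
  then show ?case using * by (fastforce simp: set_bind_pmf)
qed

lemma pmf_assoc_seq_Suc:
  assumes "set_pmf W \<subseteq> {0..n}" "0 \<le> r" "r \<le> 1"
  defines "p \<equiv> \<lambda>t. pmf (assoc_seq n r W t)"
  shows "p (Suc t) i =
    ((real n + 1 - real i) * ((1 - r) * p t i + r * (if i = 0 then 0 else p t (i - 1)))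
      + (real i + 1) * ((1 - r) * p t (i + 1) + r * p t i)) / (real n + 1)"
proof -
  have "set_pmf (add_bernoulli r (assoc_seq n r W t)) \<subseteq> {0..n + 1}"
    using set_assoc_seq[OF assms(1), of r t] by (fastforce simp: add_bernoulli_def)
  from pmf_bind_hyp_thin[OF this, of i] show ?thesis
    using assms(2,3) by (simp add: p_def pmf_add_bernoulli add_divide_distrib[symmetric] add.commute)
qed

end

theory Submission
  imports Defs
begin

text \<open>
  The chain is reversible with respect to the binomial law \<open>z\<close> with parameters \<open>n\<close> and
  \<open>r\<close>, so the right object is the density \<open>h\<close> of the current law \<open>p\<close> with respect to
  \<open>z\<close>. Since \<open>z\<close> is \<open>n choose i\<close> times a geometric sequence, ultra log-concavity of
  \<open>p\<close> is plain log-concavity of \<open>h\<close>. One step of the chain acts on densities by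
  averaging neighbours, twice: with weights \<open>n + 1 - i\<close> and \<open>i\<close> when the Bernoulli
  variable is added, and with the constant weights \<open>1 - r\<close> and \<open>r\<close> when the sum is
  thinned. Both averages preserve log-concavity (\<open>log_concave_upto_position_mix\<close>,
  \<open>log_concave_upto_adjacent_average\<close>), so every law in the sequence has a log-concave
  density.

  The chain moves by at most one unit. By summation by parts a step changes the expectation
  of \<open>f\<close> by the sum of \<open>f (i + 1) - f i\<close> against the net probability flux from \<open>i\<close> to
  \<open>i + 1\<close>. By reversibility this flux is a positive multiple of \<open>h i - h (i + 1)\<close>. A
  log-concave \<open>h\<close> first rises and then falls, so the flux is first negative and then
  nonnegative; it sums to zero because the mean is preserved. The increments of a convex
  \<open>f\<close> are nondecreasing, hence pair nonnegatively with such a flux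
  (\<open>sum_mono_mult_sign_change\<close>): expectations of convex functions increase along the
  chain.

  The comparison with the binomial law is direct, without letting \<open>t\<close> tend to infinity. The points where
  the density of \<open>W\<close> exceeds 1 form an interval, again by log-concavity. Two laws of equal
  mean where the first exceeds the second exactly on an interval are convexly ordered: an
  affine function may be subtracted from \<open>f\<close> without affecting the comparison, and the
  chord of \<open>f\<close> across that interval leaves a remainder that is nonpositive inside and
  nonnegative outside (\<open>sum_convex_le_of_excess_interval\<close>).
\<close>

section \<open>Convex functions at integer points\<close>

text \<open>
  Convexity in a form without division. It also serves for points outside a chord: renaming
  the three points so that an end of the chord is the middle one bounds \<open>f\<close> from below there.
\<close>

lemma convex_three_point:
  fixes f :: "real \<Rightarrow> real"
  assumes f: "convex_on UNIV f" and "a \<le> x" "x \<le> b"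
  shows "(b - a) * f x \<le> (b - x) * f a + (x - a) * f b"
proof (cases "a = b")
  case True
  with assms show ?thesis by simp
next
  case False
  with assms have "b - a > 0" by simp
  moreover have "f x \<le> (f b - f a) / (b - a) * (x - a) + f a"
    using convex_on_subset[OF f] assms by (intro convex_onD_Icc') auto
  ultimately show ?thesis
    by (simp add: field_simps)
qed

lemma convex_increments_mono:
  fixes f :: "real \<Rightarrow> real"
  assumes "convex_on UNIV f"
  shows "mono (\<lambda>i. f (real (i + 1)) - f (real i))"
proof (rule mono_iff_le_Suc[THEN iffD2], rule allI)
  fix i
  show "f (real (i + 1)) - f (real i) \<le> f (real (Suc i + 1)) - f (real (Suc i))"
    using convex_three_point[OF assms, of "real i" "real i + 1" "real i + 2"]
    by (simp add: algebra_simps)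
qed

text \<open>
  Because \<open>J\<close> sums to zero, \<open>g\<close> may be shifted by its value at the index where \<open>J\<close> turns
  nonnegative; then both factors of every summand have the same sign.
\<close>

lemma sum_mono_mult_sign_change:
  fixes g J :: "nat \<Rightarrow> real"
  assumes "mono g" and J: "(\<Sum>i<n. J i) = 0"
    and persist: "\<And>i j. i \<le> j \<Longrightarrow> j < n \<Longrightarrow> J i \<ge> 0 \<Longrightarrow> J j \<ge> 0"
  shows "(\<Sum>i<n. g i * J i) \<ge> 0"
proof -
  \<comment> \<open>If \<open>J\<close> is negative throughout, this is \<open>n\<close>, which is as good as any other shift.\<close>
  define k where "k = (LEAST k. k < n \<longrightarrow> J k \<ge> 0)"
  have k: "k < n \<longrightarrow> J k \<ge> 0"
    unfolding k_def by (rule LeastI[of _ n]) simp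
  have below: "J i < 0" if "i < k" for i
    using not_less_Least[OF that[unfolded k_def]] by simp
  have "0 \<le> (\<Sum>i<n. (g i - g k) * J i)"
  proof (rule sum_nonneg)
    fix i assume i: "i \<in> {..<n}"
    show "0 \<le> (g i - g k) * J i"
    proof (cases "i < k")
      case True
      with below[OF True] monoD[OF \<open>mono g\<close>, of i k] show ?thesis
        by (intro mult_nonpos_nonpos) auto
    next
      case False
      with k persist[of k i] i monoD[OF \<open>mono g\<close>, of k i] show ?thesis
        by (intro mult_nonneg_nonneg) auto
    qed
  qed
  also have "\<dots> = (\<Sum>i<n. g i * J i) - g k * (\<Sum>i<n. J i)"
    by (simp add: left_diff_distrib sum_subtractf sum_distrib_left)
  finally show ?thesis using J by simp
qed

text \<open>
  The excess of \<open>p\<close> over \<open>z\<close> sits on an interval and both have the same mass and mean, so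
  \<open>z\<close> arises from \<open>p\<close> by moving mass outwards. Subtracting from \<open>f\<close> a chord over the
  interval turns this into a comparison of signs at each point.
\<close>

lemma sum_convex_le_of_excess_interval:
  fixes p z :: "nat \<Rightarrow> real" and f :: "real \<Rightarrow> real"
  assumes f: "convex_on UNIV f"
    and mass: "(\<Sum>i\<le>n. p i) = (\<Sum>i\<le>n. z i)"
    and mean: "(\<Sum>i\<le>n. real i * p i) = (\<Sum>i\<le>n. real i * z i)"
    and interval: "\<And>s i e. s \<le> i \<Longrightarrow> i \<le> e \<Longrightarrow> e \<le> n \<Longrightarrow> p s > z s \<Longrightarrow> p e > z e \<Longrightarrow> p i > z i"
  shows "(\<Sum>i\<le>n. f (real i) * p i) \<le> (\<Sum>i\<le>n. f (real i) * z i)"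
proof (cases "\<forall>i\<le>n. p i \<le> z i")
  case True
  then have "p i = z i" if "i \<le> n" for i
    using sum_mono_inv[OF mass, of i] that by simp
  then show ?thesis by simp
next
  case False
  define D where "D = {i. i \<le> n \<and> p i > z i}"
  have "finite D" by (simp add: D_def)
  moreover have "D \<noteq> {}"
    using False unfolding D_def by (metis (mono_tags, lifting) empty_iff mem_Collect_eq not_le)
  ultimately have D: "finite D" "D \<noteq> {}" .
  \<comment> \<open>The right end is one beyond the last excess point, so that the chord is not degenerate
    when there is only one such point. At the added integer the remainder vanishes.\<close>
  define a b where "a = real (Min D)" and "b = real (Max D) + 1"
  have "Min D \<in> D" "Max D \<in> D"
    using D by auto
  have "Min D \<le> Max D"
    using D by simp
  then have ab: "a < b" by (simp add: a_def b_def)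
  \<comment> \<open>This is \<open>f\<close> minus its chord, multiplied by \<open>b - a\<close>.\<close>
  define g where "g x = (b - a) * f x - ((b - x) * f a + (x - a) * f b)" for x
  have "0 \<le> g (real i) * (z i - p i)" if "i \<le> n" for i
  proof -
    consider "real i \<le> a" | "b \<le> real i" | "Min D \<le> i" "i \<le> Max D"
      unfolding a_def b_def by linarith
    then show ?thesis
    proof cases
      case 1
      have "g (real i) \<ge> 0"
        using convex_three_point[OF f, of "real i" a b] 1 ab unfolding g_def by argo
      moreover have "g (real i) = 0 \<or> p i \<le> z i"
      proof (cases "real i = a")
        case False
        with 1 have "i < Min D" by (simp add: a_def)
        with D have "i \<notin> D" using Min_le leD by blast
        with that show ?thesis by (auto simp: D_def)
      qed (simp add: g_def)
      ultimately show ?thesis by auto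
    next
      case 2
      have "g (real i) \<ge> 0"
        using convex_three_point[OF f, of a b "real i"] 2 ab unfolding g_def by argo
      moreover have "i \<notin> D"
        using 2 Max_ge[OF D(1), of i] by (fastforce simp: b_def)
      ultimately show ?thesis
        using that by (auto simp: D_def)
    next
      case 3
      have "g (real i) \<le> 0"
        using convex_three_point[OF f, of a "real i" b] 3 unfolding g_def a_def b_def by simp
      moreover have "p i > z i"
        using interval[OF 3] \<open>Min D \<in> D\<close> \<open>Max D \<in> D\<close> by (simp add: D_def)
      ultimately show ?thesis
        by (intro mult_nonpos_nonpos) auto
    qed
  qed
  then have "0 \<le> (\<Sum>i\<le>n. g (real i) * (z i - p i))"
    by (intro sum_nonneg) simp
  also have "\<dots> = (\<Sum>i\<le>n. (b - a) * (f (real i) * z i - f (real i) * p i)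
      - (b * f a - a * f b) * (z i - p i) - (f b - f a) * (real i * z i - real i * p i))"
    by (rule sum.cong) (auto simp: g_def algebra_simps)
  also have "\<dots> = (b - a) * ((\<Sum>i\<le>n. f (real i) * z i) - (\<Sum>i\<le>n. f (real i) * p i))"
    by (simp add: sum_subtractf sum_distrib_left[symmetric] mass mean)
  finally show ?thesis
    using ab by (simp add: zero_le_mult_iff)
qed

section \<open>Log-concave sequences\<close>

text \<open>
  Positivity is part of the notion because log-concavity of a sequence with internal zeros
  neither yields unimodality nor survives averaging.
\<close>

definition log_concave_upto :: "nat \<Rightarrow> (nat \<Rightarrow> real) \<Rightarrow> bool" where
  "log_concave_upto n h \<longleftrightarrow>
     (\<forall>i\<le>n. h i > 0) \<and> (\<forall>i. i + 2 \<le> n \<longrightarrow> h i * h (i + 2) \<le> (h (i + 1))\<^sup>2)"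

text \<open>
  The ratios \<open>h (i + 1) / h i\<close> decrease. Multiplying out gives a form that also covers the
  distant pairs needed when two log-concave sequences are added.
\<close>

lemma log_concave_upto_exchange:
  assumes h: "log_concave_upto n h" and "i \<le> j" "j < n"
  shows "h i * h (j + 1) \<le> h (i + 1) * h j"
  using \<open>i \<le> j\<close> \<open>j < n\<close>
proof (induction j rule: dec_induct)
  case base
  show ?case by simp
next
  case (step j)
  have pos: "h i > 0" "h j > 0" "h (j + 1) > 0" "h (i + 1) > 0" "h (j + 2) > 0"
    using h step by (auto simp: log_concave_upto_def)
  have lc: "h j * h (j + 2) \<le> (h (j + 1))\<^sup>2"
    using h step unfolding log_concave_upto_def by simp
  have "h j * (h i * h (j + 2)) = h i * (h j * h (j + 2))"
    by simp
  also have "\<dots> \<le> h i * (h (j + 1))\<^sup>2"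
    using lc pos by (intro mult_left_mono) auto
  also have "\<dots> = (h i * h (j + 1)) * h (j + 1)"
    by (simp add: power2_eq_square)
  also have "\<dots> \<le> (h (i + 1) * h j) * h (j + 1)"
    using step pos by (intro mult_right_mono) auto
  finally have "h j * (h i * h (j + 2)) \<le> h j * (h (i + 1) * h (j + 1))"
    by (simp add: mult_ac)
  then show ?case
    using pos by simp
qed

lemma log_concave_upto_descent_persists:
  assumes h: "log_concave_upto n h" and "i \<le> j" "j < n" and "h (i + 1) \<le> h i"
  shows "h (j + 1) \<le> h j"
proof -
  have pos: "h i > 0" "h j > 0"
    using h assms(2,3) by (auto simp: log_concave_upto_def)
  have "h i * h (j + 1) \<le> h (i + 1) * h j"
    by (rule log_concave_upto_exchange[OF assms(1-3)])
  also have "\<dots> \<le> h i * h j"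
    using assms(4) pos by (intro mult_right_mono) auto
  finally show ?thesis using pos by simp
qed

text \<open>
  Log-concave sequences are unimodal: a value below the level between \<open>s\<close> and \<open>e\<close> would
  require a descent after \<open>s\<close>, which could never be reversed before \<open>e\<close>.
\<close>

lemma log_concave_upto_superlevel_interval:
  assumes h: "log_concave_upto n h" and "s \<le> i" "i \<le> e" "e \<le> n" and "h s > c" "h e > c"
  shows "h i > c"
proof (rule ccontr)
  assume i: "\<not> h i > c"
  have "\<exists>k. s \<le> k \<and> k < i \<and> h (k + 1) \<le> h k"
  proof (rule ccontr)
    assume "\<nexists>k. s \<le> k \<and> k < i \<and> h (k + 1) \<le> h k"
    then have up: "h k \<le> h (k + 1)" if "s \<le> k" "k < i" for k
      using that by (meson linorder_le_cases)
    from \<open>s \<le> i\<close> up have "h s \<le> h i"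
      by (induction i rule: dec_induct) (auto simp: less_Suc_eq intro: order_trans)
    with i \<open>h s > c\<close> show False by simp
  qed
  then obtain k where k: "k < i" "h (k + 1) \<le> h k" by blast
  from \<open>i \<le> e\<close> \<open>e \<le> n\<close> have "h e \<le> h i"
  proof (induction e rule: dec_induct)
    case (step m)
    then show ?case
      using log_concave_upto_descent_persists[OF h, of k m] k by simp
  qed simp
  with i \<open>h e > c\<close> show False by simp
qed

text \<open>
  This is the effect of thinning on densities. Expanding the square, each term is dominated
  separately, the mixed one through the exchange inequality.
\<close>

lemma log_concave_upto_adjacent_average:
  assumes d: "log_concave_upto (Suc n) d" and "q > 0" "r > 0"
  shows "log_concave_upto n (\<lambda>i. q * d i + r * d (i + 1))"
  unfolding log_concave_upto_def
proof (intro conjI allI impI)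
  fix i assume "i \<le> n"
  with assms show "q * d i + r * d (i + 1) > 0"
    by (auto simp: log_concave_upto_def intro!: add_pos_pos)
next
  fix i assume i: "i + 2 \<le> n"
  define w x y z where "w = d i" and "x = d (i + 1)" and "y = d (i + 2)" and "z = d (i + 3)"
  have "w * y \<le> x\<^sup>2"
    using d i by (auto simp: log_concave_upto_def w_def x_def y_def)
  moreover have "x * z \<le> y\<^sup>2"
    using d[unfolded log_concave_upto_def, THEN conjunct2, rule_format, of "i + 1"] i
    by (simp add: x_def y_def z_def eval_nat_numeral)
  moreover have "w * z \<le> x * y"
    using log_concave_upto_exchange[OF d, of i "i + 2"] i
    by (simp add: w_def x_def y_def z_def eval_nat_numeral)
  ultimately have "q\<^sup>2 * (w * y) + r\<^sup>2 * (x * z) + q * r * (w * z)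
      \<le> q\<^sup>2 * x\<^sup>2 + r\<^sup>2 * y\<^sup>2 + q * r * (x * y)"
    using assms(2,3) by (intro add_mono mult_left_mono) auto
  then have "(q * w + r * x) * (q * y + r * z) \<le> (q * x + r * y)\<^sup>2"
    by (simp add: power2_eq_square algebra_simps)
  then show "(q * d i + r * d (i + 1)) * (q * d (i + 2) + r * d (i + 2 + 1))
      \<le> (q * d (i + 1) + r * d (i + 1 + 1))\<^sup>2"
    by (simp add: w_def x_def y_def z_def eval_nat_numeral)
qed

text \<open>
  This is the effect on densities of adding the Bernoulli variable, up to a constant factor.
  When all products in the expansion are replaced by their log-concave bounds, what remains
  is the square of \<open>h (i + 1) - h i\<close>.
\<close>

lemma log_concave_upto_position_mix:
  assumes h: "log_concave_upto n h"
  shows "log_concave_upto (Suc n)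
    (\<lambda>i. (real n + 1 - real i) * h i + real i * h (i - 1))"
  unfolding log_concave_upto_def
proof (intro conjI allI impI)
  fix i assume i: "i \<le> Suc n"
  have pos: "h j > 0" if "j \<le> n" for j
    using h that by (simp add: log_concave_upto_def)
  show "(real n + 1 - real i) * h i + real i * h (i - 1) > 0"
  proof (cases "i = Suc n")
    case True
    then show ?thesis using pos[of n] by simp
  next
    case False
    with i pos[of i] less_imp_le[OF pos[of "i - 1"]] show ?thesis
      by (intro add_pos_nonneg mult_nonneg_nonneg) auto
  qed
next
  fix i assume i: "i + 2 \<le> Suc n"
  \<comment> \<open>At the two ends of the range \<open>w\<close> or \<open>z\<close> lies outside the domain of \<open>h\<close>,
    but there its coefficient vanishes.\<close>
  define k m where "k = real i" and "m = real n - real i - 1"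
  define w x y z where "w = h (i - 1)" and "x = h i" and "y = h (i + 1)" and "z = h (i + 2)"
  have km: "k \<ge> 0" "m \<ge> 0"
    using i by (auto simp: k_def m_def)
  have xz: "m * (x * z) \<le> m * y\<^sup>2"
  proof (cases "m = 0")
    case False
    with i have "i + 2 \<le> n" by (auto simp: m_def)
    with h have "x * z \<le> y\<^sup>2" by (simp add: log_concave_upto_def x_def y_def z_def)
    with km show ?thesis by (intro mult_left_mono)
  qed simp
  have wy: "k * (w * y) \<le> k * x\<^sup>2"
  proof (cases "k = 0")
    case False
    with i h[unfolded log_concave_upto_def, THEN conjunct2, rule_format, of "i - 1"]
    have "w * y \<le> x\<^sup>2" by (simp add: k_def x_def y_def w_def)
    with km show ?thesis by (intro mult_left_mono)
  qed simp
  have wz: "k * m * (w * z) \<le> k * m * (x * y)"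
  proof (cases "k = 0 \<or> m = 0")
    case False
    with i have "0 < i" "i + 2 \<le> n" by (auto simp: m_def k_def)
    with log_concave_upto_exchange[OF h, of "i - 1" "i + 1"]
    have "w * z \<le> x * y" by (simp add: x_def y_def z_def w_def)
    with km show ?thesis by (intro mult_left_mono) auto
  qed auto
  have "((m + 1) * y + (k + 1) * x)\<^sup>2 - ((m + 2) * x + k * w) * (m * z + (k + 2) * y)
      = (y - x)\<^sup>2 + (m + 2) * (m * y\<^sup>2 - m * (x * z)) + (k + 2) * (k * x\<^sup>2 - k * (w * y))
        + (k * m * (x * y) - k * m * (w * z))"
    by (simp add: power2_eq_square algebra_simps)
  also have "\<dots> \<ge> 0"
    using xz wy wz km by (intro add_nonneg_nonneg mult_nonneg_nonneg) auto
  finally have "((m + 2) * x + k * w) * (m * z + (k + 2) * y) \<le> ((m + 1) * y + (k + 1) * x)\<^sup>2"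
    by simp
  then show "((real n + 1 - real i) * h i + real i * h (i - 1))
      * ((real n + 1 - real (i + 2)) * h (i + 2) + real (i + 2) * h (i + 2 - 1))
    \<le> ((real n + 1 - real (i + 1)) * h (i + 1) + real (i + 1) * h (i + 1 - 1))\<^sup>2"
    by (simp add: k_def m_def w_def x_def y_def z_def algebra_simps)
qed

section \<open>Probability flux of the chain\<close>

text \<open>
  This is the net probability flow from \<open>i\<close> to \<open>i + 1\<close> in one step, multiplied by
  \<open>n + 1\<close>: the value rises from \<open>i\<close> if the Bernoulli variable is 1 and one of the
  \<open>n - i\<close> unmarked balls is removed, and falls from \<open>i + 1\<close> if that variable is 0 and
  one of the \<open>i + 1\<close> marked balls is removed.
\<close>

definition flux :: "nat \<Rightarrow> real \<Rightarrow> (nat \<Rightarrow> real) \<Rightarrow> nat \<Rightarrow> real" where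
  "flux n r p i = r * (real n - real i) * p i - (1 - r) * (real i + 1) * p (i + 1)"

text \<open>
  The total flux is the drift of the mean, and it is proportional to the distance of the mean
  from its equilibrium value \<open>n * r\<close>. So zero total flux expresses that the mean is \<open>n * r\<close>,
  both for the chain and, through detailed balance, for the binomial law itself.
\<close>

lemma sum_flux:
  "(\<Sum>i<n. flux n r p i) = real n * r * (\<Sum>i\<le>n. p i) - (\<Sum>i\<le>n. real i * p i)"
proof -
  have "(\<Sum>i<m. flux n r p i)
      = real n * r * (\<Sum>i\<le>m. p i) - (\<Sum>i\<le>m. real i * p i) - r * (real n - real m) * p m" for m
    by (induction m) (auto simp: flux_def algebra_simps)
  from this[of n] show ?thesis by simp
qed

text \<open>
  The mass at \<open>i\<close> changes by the flux coming in from the left minus the flux going out to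
  the right, so the claim is summation by parts.
\<close>

lemma sum_step_difference:
  fixes p p' f :: "nat \<Rightarrow> real"
  assumes step: "\<And>i. p' i = ((real n + 1 - real i) * ((1 - r) * p i + r * (if i = 0 then 0 else p (i - 1)))
      + (real i + 1) * ((1 - r) * p (i + 1) + r * p i)) / (real n + 1)"
    and "p (n + 1) = 0"
  shows "(real n + 1) * ((\<Sum>i\<le>n. f i * p' i) - (\<Sum>i\<le>n. f i * p i))
    = (\<Sum>i<n. (f (i + 1) - f i) * flux n r p i)"
proof -
  have balance: "(real n + 1) * (p' i - p i)
      = (if i = 0 then 0 else flux n r p (i - 1)) - flux n r p i" for i
  proof -
    have "(real n + 1) * p' i = (real n + 1 - real i) * ((1 - r) * p i + r * (if i = 0 then 0 else p (i - 1)))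
      + (real i + 1) * ((1 - r) * p (i + 1) + r * p i)"
      unfolding step by simp
    then show ?thesis
      by (cases i) (auto simp: flux_def algebra_simps)
  qed
  have "(\<Sum>i\<le>m. f i * ((real n + 1) * (p' i - p i)))
      = (\<Sum>i<m. (f (i + 1) - f i) * flux n r p i) - f m * flux n r p m" for m
    unfolding balance by (induction m) (auto simp: algebra_simps)
  from this[of n] have "(\<Sum>i\<le>n. f i * ((real n + 1) * (p' i - p i)))
      = (\<Sum>i<n. (f (i + 1) - f i) * flux n r p i)"
    using \<open>p (n + 1) = 0\<close> by (simp add: flux_def)
  then show ?thesis
    by (simp add: algebra_simps sum_subtractf sum_distrib_left sum.distrib)
qed

section \<open>Densities with respect to the binomial law\<close>

lemma binomial_detailed_balance:
  assumes "0 \<le> r" "r \<le> 1"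
  shows "(1 - r) * (real i + 1) * pmf (binomial_pmf n r) (i + 1)
    = r * (real n - real i) * pmf (binomial_pmf n r) i"
proof (cases "i < n")
  case True
  have "(real i + 1) * real (n choose (i + 1)) = real (n - i) * real (n choose i)"
    using binomial_absorb_comp[of n i] binomial_absorption[of i "n"]
    by (metis Suc_eq_plus1 of_nat_Suc of_nat_mult add.commute)
  moreover have "n - i = Suc (n - (i + 1))"
    using True by simp
  ultimately show ?thesis
    using assms True by (simp add: of_nat_diff)
next
  case False
  then show ?thesis using assms by (cases "i = n") (auto simp: binomial_eq_0)
qed

definition binomial_density :: "nat \<Rightarrow> real \<Rightarrow> nat pmf \<Rightarrow> nat \<Rightarrow> real" where
  "binomial_density n r P i = pmf P i / pmf (binomial_pmf n r) i"

lemma pmf_binomial_pos: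
  assumes "0 < r" "r < 1" "i \<le> n"
  shows "pmf (binomial_pmf n r) i > 0"
  using assms by simp

lemma pmf_eq_density:
  assumes "0 < r" "r < 1" "set_pmf P \<subseteq> {0..n}"
  shows "pmf P i = pmf (binomial_pmf n r) i * binomial_density n r P i"
proof (cases "i \<le> n")
  case True
  then show ?thesis
    using pmf_binomial_pos[OF assms(1,2) True] by (simp add: binomial_density_def)
next
  case False
  with assms(3) have "pmf P i = 0" by (auto simp: pmf_eq_0_set_pmf)
  then show ?thesis by (simp add: binomial_density_def)
qed

text \<open>
  Detailed balance makes the coefficients of the two flows between \<open>i\<close> and \<open>i + 1\<close> equal
  once \<open>p\<close> is written as \<open>z * h\<close>, so the sign of the flux is read off from \<open>h\<close> alone.
\<close>

lemma flux_eq_density_drop: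
  assumes "0 < r" "r < 1" "set_pmf P \<subseteq> {0..n}"
  shows "flux n r (pmf P) i = r * (real n - real i) * pmf (binomial_pmf n r) i
    * (binomial_density n r P i - binomial_density n r P (i + 1))"
proof -
  have "(1 - r) * (real i + 1) * pmf P (i + 1)
      = ((1 - r) * (real i + 1) * pmf (binomial_pmf n r) (i + 1)) * binomial_density n r P (i + 1)"
    by (subst pmf_eq_density[OF assms, of "i + 1"]) (simp only: mult.assoc)
  also have "\<dots> = r * (real n - real i) * pmf (binomial_pmf n r) i * binomial_density n r P (i + 1)"
    using assms by (subst binomial_detailed_balance) auto
  finally show ?thesis
    unfolding flux_def pmf_eq_density[OF assms, of i] by (simp add: algebra_simps)
qed

text \<open>
  Here \<open>d / (n + 1)\<close> is the density of the law after adding the Bernoulli variable, with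
  respect to the binomial law with parameters \<open>n + 1\<close> and \<open>r\<close>. By detailed balance the
  mass received from the two neighbours of \<open>i\<close> becomes a multiple of the binomial weight at
  \<open>i\<close> itself, which then cancels.
\<close>

lemma binomial_density_Suc:
  fixes t :: nat
  assumes r: "0 < r" "r < 1" and W: "set_pmf W \<subseteq> {0..n}" and "i \<le> n"
  defines "h \<equiv> binomial_density n r (assoc_seq n r W t)"
  defines "d \<equiv> \<lambda>i. (real n + 1 - real i) * h i + real i * h (i - 1)"
  shows "binomial_density n r (assoc_seq n r W (Suc t)) i
    = ((1 - r) * d i + r * d (i + 1)) / (real n + 1)"
proof -
  define z p where "z = pmf (binomial_pmf n r)" and "p = pmf (assoc_seq n r W t)"
  have p: "p j = z j * h j" for j
    unfolding z_def p_def h_def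
    using pmf_eq_density[OF r set_assoc_seq[OF W]] .
  have z: "z i > 0"
    unfolding z_def using pmf_binomial_pos[OF r \<open>i \<le> n\<close>] .
  have up: "(real i + 1) * ((1 - r) * p (i + 1)) = z i * (r * (real n - real i) * h (i + 1))"
    using binomial_detailed_balance[of r i n, folded z_def] r by (simp add: p mult_ac)
  have down: "(real n + 1 - real i) * (r * (if i = 0 then 0 else p (i - 1)))
      = z i * ((1 - r) * real i * h (i - 1))"
  proof (cases i)
    case (Suc j)
    then show ?thesis
      using binomial_detailed_balance[of r j n, folded z_def] r
      by (simp add: p mult_ac add.commute)
  qed simp
  have "(real n + 1) * pmf (assoc_seq n r W (Suc t)) i
      = (real n + 1 - real i) * ((1 - r) * p i + r * (if i = 0 then 0 else p (i - 1)))
        + (real i + 1) * ((1 - r) * p (i + 1) + r * p i)"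
    unfolding p_def using r by (subst pmf_assoc_seq_Suc[OF W]) auto
  also have "\<dots> = (real n + 1 - real i) * ((1 - r) * p i) + (real i + 1) * (r * p i)
      + (real n + 1 - real i) * (r * (if i = 0 then 0 else p (i - 1)))
      + (real i + 1) * ((1 - r) * p (i + 1))"
    by (simp add: algebra_simps)
  also have "\<dots> = z i * ((1 - r) * d i + r * d (i + 1))"
    unfolding up down p[of i] by (simp add: d_def algebra_simps)
  finally show ?thesis
    using z by (simp add: binomial_density_def z_def[symmetric] field_simps)
qed

lemma log_concave_upto_divide:
  assumes "log_concave_upto n h" "c > 0" "\<And>i. i \<le> n \<Longrightarrow> g i = h i / c"
  shows "log_concave_upto n g"
  unfolding log_concave_upto_def
proof (intro conjI allI impI)
  fix i assume "i \<le> n"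
  with assms show "g i > 0" by (simp add: log_concave_upto_def)
next
  fix i assume "i + 2 \<le> n"
  with assms show "g i * g (i + 2) \<le> (g (i + 1))\<^sup>2"
    by (simp add: log_concave_upto_def power_divide power2_eq_square divide_right_mono)
qed

lemma log_concave_density_assoc_seq:
  assumes r: "0 < r" "r < 1" and W: "set_pmf W \<subseteq> {0..n}"
    and lc: "log_concave_upto n (binomial_density n r W)"
  shows "log_concave_upto n (binomial_density n r (assoc_seq n r W t))"
proof (induction t)
  case 0
  show ?case using lc by simp
next
  case (Suc t)
  show ?case
  proof (rule log_concave_upto_divide)
    show "log_concave_upto n (\<lambda>i. (1 - r) *
         ((real n + 1 - real i) * binomial_density n r (assoc_seq n r W t) i
          + real i * binomial_density n r (assoc_seq n r W t) (i - 1))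
        + r * ((real n + 1 - real (i + 1)) * binomial_density n r (assoc_seq n r W t) (i + 1)
          + real (i + 1) * binomial_density n r (assoc_seq n r W t) (i + 1 - 1)))"
      using log_concave_upto_adjacent_average[OF log_concave_upto_position_mix[OF Suc], of "1 - r" r] r
      by simp
    show "real n + 1 > 0" by simp
  qed (rule binomial_density_Suc[OF r W])
qed

text \<open>
  The binomial weights differ from \<open>n choose i\<close> by a geometric factor, for which the
  log-concavity inequality is an equality.
\<close>

lemma ULC_imp_log_concave_density:
  assumes r: "0 < r" "r < 1" and "ULC n W" and supp: "set_pmf W = {0..n}"
  shows "log_concave_upto n (binomial_density n r W)"
  unfolding log_concave_upto_def
proof (intro conjI allI impI)
  fix i assume i: "i \<le> n"
  with supp have "pmf W i > 0" by (simp add: pmf_positive)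
  with pmf_binomial_pos[OF r i] show "binomial_density n r W i > 0"
    by (simp add: binomial_density_def)
next
  fix i assume i: "i + 2 \<le> n"
  define a where "a j = pmf W j / real (n choose j)" for j
  define g where "g j = r ^ j * (1 - r) ^ (n - j)" for j
  have h: "binomial_density n r W j = a j / g j" for j
    using r by (simp add: binomial_density_def a_def g_def mult.assoc)
  have "n - i = (n - (i + 2)) + 2" "n - (i + 1) = (n - (i + 2)) + 1"
    using i by auto
  then have g: "g i * g (i + 2) = (g (i + 1))\<^sup>2"
    unfolding g_def by (simp add: power_add power2_eq_square)
  have "a i * a (i + 2) \<le> (a (i + 1))\<^sup>2"
    using \<open>ULC n W\<close> i by (simp add: ULC_def a_def power_divide)
  then show "binomial_density n r W i * binomial_density n r W (i + 2)
      \<le> (binomial_density n r W (i + 1))\<^sup>2"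
    unfolding h times_divide_times_eq power_divide g by (rule divide_right_mono) simp
qed

section \<open>Expectations on a finite range\<close>

lemma expectation_eq_sum_atMost:
  fixes f :: "nat \<Rightarrow> real"
  assumes "set_pmf P \<subseteq> {0..n}"
  shows "measure_pmf.expectation P f = (\<Sum>i\<le>n. f i * pmf P i)"
  by (rule integral_measure_pmf_real) (use assms in auto)

lemma cx_leI:
  assumes "set_pmf P \<subseteq> {0..n}" "set_pmf Q \<subseteq> {0..n}"
    and "\<And>f. convex_on UNIV f \<Longrightarrow>
      (\<Sum>i\<le>n. f (real i) * pmf P i) \<le> (\<Sum>i\<le>n. f (real i) * pmf Q i)"
  shows "P \<le>cx Q"
  unfolding convex_order_def using assms
  by (auto simp: expectation_eq_sum_atMost)

lemma sum_pmf_atMost: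
  fixes n :: nat
  assumes "set_pmf P \<subseteq> {0..n}"
  shows "(\<Sum>i\<le>n. pmf P i) = 1"
  using assms by (intro sum_pmf_eq_1) auto

lemma mean_assoc_seq:
  assumes r: "0 \<le> r" "r \<le> 1" and W: "set_pmf W \<subseteq> {0..n}"
    and mean: "(\<Sum>i\<le>n. real i * pmf W i) = real n * r"
  shows "(\<Sum>i\<le>n. real i * pmf (assoc_seq n r W t) i) = real n * r"
proof (induction t)
  case 0
  show ?case using mean by simp
next
  case (Suc t)
  let ?p = "\<lambda>t. pmf (assoc_seq n r W t)"
  note supp = set_assoc_seq[OF W, of r t]
  have "?p t (n + 1) = 0"
    using supp by (auto simp: pmf_eq_0_set_pmf)
  from sum_step_difference[OF pmf_assoc_seq_Suc[OF W r] this, of real]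
  have "(real n + 1) * ((\<Sum>i\<le>n. real i * ?p (Suc t) i) - (\<Sum>i\<le>n. real i * ?p t i))
      = (\<Sum>i<n. flux n r (?p t) i)"
    by simp
  also have "\<dots> = 0"
    using Suc sum_pmf_atMost[OF supp] by (simp add: sum_flux)
  finally show ?case
    using Suc by simp
qed

text \<open>
  The flux of the binomial law vanishes at every edge, which forces its mean by the formula
  for the total flux.
\<close>

lemma mean_binomial:
  assumes "0 \<le> r" "r \<le> 1"
  shows "(\<Sum>i\<le>n. real i * pmf (binomial_pmf n r) i) = real n * r"
proof -
  have "(\<Sum>i\<le>n. pmf (binomial_pmf n r) i) = 1"
    using assms by (intro sum_pmf_eq_1) (auto simp: set_pmf_binomial_eq)
  moreover have "flux n r (pmf (binomial_pmf n r)) i = 0" for i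
    unfolding flux_def using binomial_detailed_balance[OF assms] by simp
  ultimately show ?thesis
    using sum_flux[of n r "pmf (binomial_pmf n r)"] by simp
qed

text \<open>
  The flux follows the descents of a unimodal density, so it changes sign only once, from
  negative to nonnegative, while the increments of \<open>f\<close> are nondecreasing.
\<close>

lemma expectation_convex_mono_step:
  fixes f :: "real \<Rightarrow> real"
  assumes r: "0 < r" "r < 1" and W: "set_pmf W \<subseteq> {0..n}"
    and mean: "(\<Sum>i\<le>n. real i * pmf W i) = real n * r"
    and lc: "log_concave_upto n (binomial_density n r W)"
    and f: "convex_on UNIV f"
  shows "(\<Sum>i\<le>n. f (real i) * pmf (assoc_seq n r W t) i)
    \<le> (\<Sum>i\<le>n. f (real i) * pmf (assoc_seq n r W (Suc t)) i)"
proof -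
  let ?p = "pmf (assoc_seq n r W t)"
  let ?h = "binomial_density n r (assoc_seq n r W t)"
  have r': "0 \<le> r" "r \<le> 1" using r by auto
  note supp = set_assoc_seq[OF W, of r t]
  have flux_sign: "flux n r ?p i \<ge> 0 \<longleftrightarrow> ?h (i + 1) \<le> ?h i" if "i < n" for i
  proof -
    define c where "c = r * (real n - real i) * pmf (binomial_pmf n r) i"
    have "c > 0"
      unfolding c_def using r(1) that pmf_binomial_pos[OF r, of i n]
      by (intro mult_pos_pos) simp_all
    then show ?thesis
      unfolding flux_eq_density_drop[OF r supp] c_def[symmetric] by (simp add: zero_le_mult_iff)
  qed
  have "?p (n + 1) = 0"
    using supp by (auto simp: pmf_eq_0_set_pmf)
  from sum_step_difference[OF pmf_assoc_seq_Suc[OF W r'] this, of "\<lambda>i. f (real i)"]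
  have "(real n + 1) * ((\<Sum>i\<le>n. f (real i) * pmf (assoc_seq n r W (Suc t)) i)
        - (\<Sum>i\<le>n. f (real i) * ?p i))
      = (\<Sum>i<n. (f (real (i + 1)) - f (real i)) * flux n r ?p i)" .
  also have "\<dots> \<ge> 0"
  proof (rule sum_mono_mult_sign_change[OF convex_increments_mono[OF f]])
    show "(\<Sum>i<n. flux n r ?p i) = 0"
      using mean_assoc_seq[OF r' W mean, of t] sum_pmf_atMost[OF supp] by (simp add: sum_flux)
  next
    fix i j assume "i \<le> j" "j < n" "flux n r ?p i \<ge> 0"
    then show "flux n r ?p j \<ge> 0"
      using log_concave_upto_descent_persists[OF log_concave_density_assoc_seq[OF r W lc], of i j]
      by (simp add: flux_sign)
  qed
  finally show ?thesis
    by (simp add: zero_le_mult_iff)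
qed

theorem theorem4p2:
  fixes n :: nat and r :: real and W Z :: "nat pmf"
  assumes "n \<ge> 1"
    and "ULC n W"
    and "set_pmf W = {0..n}"
    and "measure_pmf.expectation W real = real n * r"
    and "real n * r > 0"
    and "Z = binomial_pmf n r"
  shows "(\<forall>t u. t \<le> u \<longrightarrow> assoc_seq n r W t \<le>cx assoc_seq n r W u) \<and> W \<le>cx Z"
proof -
  have W: "set_pmf W \<subseteq> {0..n}" using assms(3) by simp
  have mean: "(\<Sum>i\<le>n. real i * pmf W i) = real n * r"
    using assms(4) expectation_eq_sum_atMost[OF W, of real] by simp
  have "r > 0"
    using assms(1,5) by (simp add: zero_less_mult_iff)
  \<comment> \<open>Full support gives positive mass to 0, so the mean stays below \<open>n\<close>.\<close>
  have "r < 1"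
  proof -
    have "0 < (\<Sum>i\<le>n. (real n - real i) * pmf W i)"
    proof (rule sum_pos2[of _ 0])
      show "0 < (real n - real 0) * pmf W 0"
        using assms(1,3) by (simp add: pmf_positive)
    qed auto
    also have "\<dots> = real n * (1 - r)"
      using mean sum_pmf_atMost[OF W]
      by (simp add: left_diff_distrib sum_subtractf sum_distrib_left[symmetric] algebra_simps)
    finally show ?thesis
      by (simp add: zero_less_mult_iff)
  qed
  note r = \<open>r > 0\<close> \<open>r < 1\<close>
  have lc: "log_concave_upto n (binomial_density n r W)"
    by (rule ULC_imp_log_concave_density[OF r assms(2,3)])
  have "assoc_seq n r W t \<le>cx assoc_seq n r W u" if "t \<le> u" for t u
  proof (rule cx_leI[OF set_assoc_seq[OF W] set_assoc_seq[OF W]])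
    fix f :: "real \<Rightarrow> real" assume f: "convex_on UNIV f"
    show "(\<Sum>i\<le>n. f (real i) * pmf (assoc_seq n r W t) i)
        \<le> (\<Sum>i\<le>n. f (real i) * pmf (assoc_seq n r W u) i)"
      using lift_Suc_mono_le[of "\<lambda>t. \<Sum>i\<le>n. f (real i) * pmf (assoc_seq n r W t) i",
          OF expectation_convex_mono_step[OF r W mean lc f] that] .
  qed
  moreover have "W \<le>cx Z"
  proof (rule cx_leI[OF W])
    show Z: "set_pmf Z \<subseteq> {0..n}"
      using r by (auto simp: assms(6))
    fix f :: "real \<Rightarrow> real" assume f: "convex_on UNIV f"
    show "(\<Sum>i\<le>n. f (real i) * pmf W i) \<le> (\<Sum>i\<le>n. f (real i) * pmf Z i)"
    proof (rule sum_convex_le_of_excess_interval[OF f])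
      show "(\<Sum>i\<le>n. pmf W i) = (\<Sum>i\<le>n. pmf Z i)"
        using sum_pmf_atMost[OF W] sum_pmf_atMost[OF Z] by simp
      show "(\<Sum>i\<le>n. real i * pmf W i) = (\<Sum>i\<le>n. real i * pmf Z i)"
        using mean mean_binomial[of r n] r by (simp add: assms(6))
    next
      have excess: "pmf W i > pmf Z i \<longleftrightarrow> binomial_density n r W i > 1" if "i \<le> n" for i
        using pmf_binomial_pos[OF r that] by (simp add: binomial_density_def assms(6))
      fix s i e assume "s \<le> i" "i \<le> e" "e \<le> n" "pmf W s > pmf Z s" "pmf W e > pmf Z e"
      then show "pmf W i > pmf Z i"
        using log_concave_upto_superlevel_interval[OF lc, of s i e 1] by (simp add: excess)
    qed
  qed
  ultimately show ?thesis by blast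
qed

end
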